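(* Let $G$ be a connected graph with at least two vertices. Then $\hom(G_2,Y(G))>\hom(G_2,\tilde Y(G))$.
   Context: All graphs are finite, simple and undirected. $\hom(F,H)$ is the number of homomorphisms (edge-preserving maps $V(F)\to V(H)$) from $F$ to $H$. The 2-subdivision $G_2$ of $G$ is obtained by replacing every edge $uv$ of $G$ by a path $u,w_{u,v},w_{v,u},v$ with two new vertices. For each vertex $u$ of $G$ let $A(u)=\{a(u,v): uv\in E(G)\}$ and $B(u)=\{b(u,v): uv\in E(G)\}$ be sets of new pairwise distinct elements, and let $M(u)$ be the set of all subsets of $A(u)$ of even cardinality, each regarded as a new vertex. The gadget $Y(u)$ has vertex set $A(u)\cup B(u)\cup M(u)$ and, for $m\in M(u)$, the edge $\{a(u,v),m\}$ if $a(u,v)\in m$ and the edge $\{b(u,v),m\}$ if $a(u,v)\notin m$. $Y(G)$ is the disjoint union of all gadgets $Y(u)$ together with, for each edge $uv\in E(G)$, the edges $\{a(u,v),a(v,u)\}$ and $\{b(u,v),b(v,u)\}$. $\tilde Y(G)$ is obtained from $Y(G)$ by choosing one edge $u_0v_0$ of $G$ and replacing $\{a(u_0,v_0),a(v_0,u_0)\}$, $\{b(u_0,v_0),b(v_0,u_0)\}$ by $\{a(u_0,v_0),b(v_0,u_0)\}$, $\{b(u_0,v_0),a(v_0,u_0)\}$ (up to isomorphism independent of the chosen edge). *)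

theory Defs
  imports "Graph_Theory.Digraph_Component" "Graph_Theory.Pair_Digraph" "HOL-Library.FuncSet"
begin

text \<open>
  A finite simple undirected graph is a \<^locale>\<open>pair_graph\<close>: an undirected edge \<open>uv\<close>
  is represented by the two arcs \<open>(u, v)\<close> and \<open>(v, u)\<close>.
\<close>

definition homs :: "'a pair_pre_digraph \<Rightarrow> 'b pair_pre_digraph \<Rightarrow> ('a \<Rightarrow> 'b) set" where
  "homs F H = {f \<in> pverts F \<rightarrow>\<^sub>E pverts H. \<forall>(x, y) \<in> parcs F. (f x, f y) \<in> parcs H}"

definition hom_count :: "'a pair_pre_digraph \<Rightarrow> 'b pair_pre_digraph \<Rightarrow> nat" where
  "hom_count F H = card (homs F H)"

text \<open>\<open>Sub (u, v)\<close> is the subdivision vertex $w_{u,v}$, the one adjacent to \<open>u\<close>.\<close>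

datatype 'a sub_vertex = Orig 'a | Sub "'a \<times> 'a"

definition two_subdivision :: "'a pair_pre_digraph \<Rightarrow> 'a sub_vertex pair_pre_digraph" where
  "two_subdivision G =
    \<lparr> pverts = Orig ` pverts G \<union> Sub ` parcs G,
      parcs = symcl ({(Orig u, Sub (u, v)) | u v. (u, v) \<in> parcs G}
                   \<union> {(Sub (u, v), Sub (v, u)) | u v. (u, v) \<in> parcs G}) \<rparr>"

text \<open>
  \<open>AV (u, v)\<close> is $a(u,v)$ and \<open>BV (u, v)\<close> is $b(u,v)$. \<open>MV u m\<close> is the element \<open>m\<close> of $M(u)$
  regarded as a vertex, where a subset of $A(u)$ is given by the set of the index pairs \<open>(u, v)\<close>
  of its elements. The tag \<open>u\<close> keeps the copies of the empty set in different $M(u)$ apart.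
\<close>

datatype 'a y_vertex = AV "'a \<times> 'a" | BV "'a \<times> 'a" | MV 'a "('a \<times> 'a) set"

definition out_pairs :: "'a pair_pre_digraph \<Rightarrow> 'a \<Rightarrow> ('a \<times> 'a) set" where
  "out_pairs G u = {(u, v) | v. (u, v) \<in> parcs G}"

definition even_subsets :: "'a pair_pre_digraph \<Rightarrow> 'a \<Rightarrow> ('a \<times> 'a) set set" where
  "even_subsets G u = {m. m \<subseteq> out_pairs G u \<and> even (card m)}"

definition gadget :: "'a pair_pre_digraph \<Rightarrow> 'a \<Rightarrow> 'a y_vertex pair_pre_digraph" where
  "gadget G u =
    \<lparr> pverts = AV ` out_pairs G u \<union> BV ` out_pairs G u \<union> MV u ` even_subsets G u,
      parcs = symcl ({(AV e, MV u m) | e m. e \<in> out_pairs G u \<and> m \<in> even_subsets G u \<and> e \<in> m}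
                   \<union> {(BV e, MV u m) | e m. e \<in> out_pairs G u \<and> m \<in> even_subsets G u \<and> e \<notin> m}) \<rparr>"

definition Y_graph :: "'a pair_pre_digraph \<Rightarrow> 'a y_vertex pair_pre_digraph" where
  "Y_graph G =
    \<lparr> pverts = (\<Union>u \<in> pverts G. pverts (gadget G u)),
      parcs = (\<Union>u \<in> pverts G. parcs (gadget G u))
        \<union> symcl ({(AV (u, v), AV (v, u)) | u v. (u, v) \<in> parcs G}
               \<union> {(BV (u, v), BV (v, u)) | u v. (u, v) \<in> parcs G}) \<rparr>"

definition Y_twisted :: "'a pair_pre_digraph \<Rightarrow> 'a \<Rightarrow> 'a \<Rightarrow> 'a y_vertex pair_pre_digraph" where
  "Y_twisted G u\<^sub>0 v\<^sub>0 =
    \<lparr> pverts = pverts (Y_graph G),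
      parcs = (parcs (Y_graph G)
                - symcl {(AV (u\<^sub>0, v\<^sub>0), AV (v\<^sub>0, u\<^sub>0)), (BV (u\<^sub>0, v\<^sub>0), BV (v\<^sub>0, u\<^sub>0))})
              \<union> symcl {(AV (u\<^sub>0, v\<^sub>0), BV (v\<^sub>0, u\<^sub>0)), (BV (u\<^sub>0, v\<^sub>0), AV (v\<^sub>0, u\<^sub>0))} \<rparr>"

lemma symcl_iff: "(x, y) \<in> symcl R \<longleftrightarrow> (x, y) \<in> R \<or> (y, x) \<in> R"
  by (auto simp: symcl_def)

lemma pair_graphI:
  assumes "finite (pverts G)"
    and "\<And>x y. (x, y) \<in> parcs G \<Longrightarrow> x \<in> pverts G \<and> y \<in> pverts G \<and> x \<noteq> y \<and> (y, x) \<in> parcs G"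
  shows "pair_graph G"
proof -
  have "parcs G \<subseteq> pverts G \<times> pverts G"
    using assms(2) by auto
  then have "finite (parcs G)"
    using assms(1) by (meson finite_SigmaI finite_subset)
  then show ?thesis
    using assms by unfold_locales (auto simp: symmetric_def sym_def)
qed

context pair_graph
begin

lemma parcs_sym: "(u, v) \<in> parcs G \<Longrightarrow> (v, u) \<in> parcs G"
  using pair_sym_arcs by (auto simp: symmetric_def sym_def)

lemma parcs_irrefl: "(u, u) \<notin> parcs G"
  using pair_no_loops by fastforce

lemma pair_graph_two_subdivision: "pair_graph (two_subdivision G)"
  by (rule pair_graphI)
    (auto simp: two_subdivision_def symcl_iff pair_finite_verts pair_finite_arcs parcs_irrefl
      intro: parcs_sym dest: in_arcsD1 in_arcsD2)

lemma finite_out_pairs: "finite (out_pairs G u)"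
  by (rule finite_subset[OF _ pair_finite_arcs]) (auto simp: out_pairs_def)

lemma finite_even_subsets: "finite (even_subsets G u)"
  by (rule finite_subset[of _ "Pow (out_pairs G u)"])
    (auto simp: even_subsets_def finite_out_pairs)

lemma pair_graph_gadget: "pair_graph (gadget G u)"
  by (rule pair_graphI)
    (auto simp: gadget_def symcl_iff finite_out_pairs finite_even_subsets)

lemma AV_in_Y_graph: "(u, v) \<in> parcs G \<Longrightarrow> AV (u, v) \<in> pverts (Y_graph G)"
  and BV_in_Y_graph: "(u, v) \<in> parcs G \<Longrightarrow> BV (u, v) \<in> pverts (Y_graph G)"
  by (auto simp: Y_graph_def gadget_def out_pairs_def intro!: bexI[of _ u] dest: in_arcsD1)

lemma pair_graph_Y_graph: "pair_graph (Y_graph G)"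
proof (rule pair_graphI)
  show "finite (pverts (Y_graph G))"
    using pair_finite_verts
    by (auto simp: Y_graph_def gadget_def finite_out_pairs finite_even_subsets)
next
  fix x y assume "(x, y) \<in> parcs (Y_graph G)"
  then consider
      (gadget) u where "u \<in> pverts G" "(x, y) \<in> parcs (gadget G u)"
    | (link) u v where "(u, v) \<in> parcs G"
        "x = AV (u, v) \<and> y = AV (v, u) \<or> x = BV (u, v) \<and> y = BV (v, u)"
    unfolding Y_graph_def by (auto simp: symcl_iff dest: parcs_sym)
  then show "x \<in> pverts (Y_graph G) \<and> y \<in> pverts (Y_graph G) \<and> x \<noteq> y \<and> (y, x) \<in> parcs (Y_graph G)"
  proof cases
    case gadget
    then show ?thesis by (force simp: Y_graph_def gadget_def symcl_iff)
  next
    case link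
    then have "(v, u) \<in> parcs G" "u \<noteq> v"
      using parcs_sym parcs_irrefl by auto
    with link show ?thesis
      using AV_in_Y_graph BV_in_Y_graph by (auto simp: Y_graph_def symcl_iff)
  qed
qed

lemma pair_graph_Y_twisted:
  assumes "(u\<^sub>0, v\<^sub>0) \<in> parcs G"
  shows "pair_graph (Y_twisted G u\<^sub>0 v\<^sub>0)"
proof -
  interpret Y: pair_graph "Y_graph G" by (rule pair_graph_Y_graph)
  show ?thesis
    using assms parcs_sym[OF assms] Y.pair_finite_verts
    by (intro pair_graphI)
      (auto simp: Y_twisted_def symcl_iff Y.parcs_irrefl
        intro: AV_in_Y_graph BV_in_Y_graph Y.parcs_sym dest: Y.in_arcsD1 Y.in_arcsD2)
qed

end

end

theory Submission
  imports Defs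
begin

text \<open>
  Both \<open>Y(G)\<close> and its twist project onto \<open>G\<^sub>2\<close>. Reading \<open>b\<close> as the bit 0, \<open>a\<close> as the bit 1 and a
  vertex of \<open>M(u)\<close> as a vector of bits, the lifts of a fixed map \<open>\<phi>\<close> to a homomorphism into \<open>Y(G)\<close>
  solve a homogeneous linear system over the field with two elements, and the lifts into the twist
  solve an inhomogeneous version of the same system. Adding a fixed twisted lift of \<open>\<phi>\<close> therefore
  maps the twisted lifts of \<open>\<phi>\<close> injectively to the untwisted ones. For \<open>\<phi> = id\<close> there is an
  untwisted lift but no twisted one: the arcs on which the bit is 1 would be even in number, by
  the parity condition at each vertex of \<open>G\<close>, and odd in number, because they come in pairs of
  opposite arcs except at the twisted edge.
\<close>

section \<open>Parity of cardinalities\<close>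

lemma even_card_sym_diff:
  assumes "finite A" "finite B" "even (card A)" "even (card B)"
  shows "even (card (sym_diff A B))"
proof -
  have "card A = card (A - B) + card (A \<inter> B)" "card B = card (B - A) + card (A \<inter> B)"
    using assms(1,2) by (metis Int_commute card_Int_Diff add.commute)+
  moreover have "card (sym_diff A B) = card (A - B) + card (B - A)"
    using assms(1,2) by (intro card_Un_disjoint) auto
  ultimately show ?thesis
    using assms(3,4) by presburger
qed

text \<open>Each pair is matched with its reverse, and irreflexivity makes the two distinct; the
  induction removes one such couple at a time.\<close>

lemma even_card_sym_irrefl:
  assumes "finite R" "sym R" "irrefl R"
  shows "even (card R)"
  using assms
proof (induction R rule: finite_psubset_induct)
  case (psubset R)
  show ?case
  proof (cases "R = {}")
    case False
    then obtain x y where xy: "(x, y) \<in> R" by auto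
    let ?S = "R - {(x, y), (y, x)}"
    have yx: "(y, x) \<in> R" "x \<noteq> y"
      using xy psubset.prems by (auto simp: sym_def irrefl_def)
    have "even (card ?S)"
      using xy psubset.prems by (intro psubset.IH) (auto simp: sym_def irrefl_def)
    moreover have "card R = card ?S + card {(x, y), (y, x)}"
      using xy yx psubset.hyps by (metis Diff_partition card_Diff_subset card_mono
          empty_subsetI finite.emptyI finite.insertI insert_subset le_add_diff_inverse2)
    ultimately show ?thesis
      using yx(2) by simp
  qed simp
qed

section \<open>Bit arithmetic on the vertices of \<open>Y_graph G\<close>\<close>

fun Y_proj :: "'a y_vertex \<Rightarrow> 'a sub_vertex" where
  "Y_proj (AV e) = Sub e"
| "Y_proj (BV e) = Sub e"
| "Y_proj (MV u m) = Orig u"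

text \<open>Only meaningful for two vertices with the same projection.\<close>

fun Y_add :: "'a y_vertex \<Rightarrow> 'a y_vertex \<Rightarrow> 'a y_vertex" where
  "Y_add (AV e) (AV e') = BV e"
| "Y_add (BV e) (AV e') = AV e"
| "Y_add (MV u m) (MV u' m') = MV u (sym_diff m m')"
| "Y_add x y = x"

text \<open>\<open>T\<close> is the set of the twisted arcs.\<close>

fun Y_adj :: "'a pair_pre_digraph \<Rightarrow> ('a \<times> 'a) set \<Rightarrow> 'a y_vertex \<Rightarrow> 'a y_vertex \<Rightarrow> bool" where
  "Y_adj G T (AV e) (AV e') \<longleftrightarrow> e \<in> parcs G \<and> e' = prod.swap e \<and> e \<notin> T"
| "Y_adj G T (BV e) (BV e') \<longleftrightarrow> e \<in> parcs G \<and> e' = prod.swap e \<and> e \<notin> T"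
| "Y_adj G T (AV e) (BV e') \<longleftrightarrow> e \<in> parcs G \<and> e' = prod.swap e \<and> e \<in> T"
| "Y_adj G T (BV e) (AV e') \<longleftrightarrow> e \<in> parcs G \<and> e' = prod.swap e \<and> e \<in> T"
| "Y_adj G T (AV e) (MV u m) \<longleftrightarrow> e \<in> out_pairs G u \<and> m \<in> even_subsets G u \<and> e \<in> m"
| "Y_adj G T (MV u m) (AV e) \<longleftrightarrow> e \<in> out_pairs G u \<and> m \<in> even_subsets G u \<and> e \<in> m"
| "Y_adj G T (BV e) (MV u m) \<longleftrightarrow> e \<in> out_pairs G u \<and> m \<in> even_subsets G u \<and> e \<notin> m"
| "Y_adj G T (MV u m) (BV e) \<longleftrightarrow> e \<in> out_pairs G u \<and> m \<in> even_subsets G u \<and> e \<notin> m"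
| "Y_adj G T (MV u m) (MV u' m') \<longleftrightarrow> False"

lemma Y_proj_add: "Y_proj (Y_add x y) = Y_proj x"
  by (cases "(x, y)" rule: Y_add.cases) auto

text \<open>On a fibre of \<open>Y_proj\<close>, adding \<open>z\<close> is a translation over the
  field with two elements; the default equation of \<open>Y_add\<close> is there the addition of the
  bit 0.\<close>

lemma Y_add_cancel_right:
  assumes "Y_proj x = Y_proj z" "Y_proj y = Y_proj z" "Y_add x z = Y_add y z"
  shows "x = y"
  using assms by (cases x; cases y; cases z) auto

context pair_graph
begin

lemma sym_diff_even_subsets:
  assumes "m \<in> even_subsets G u" "m' \<in> even_subsets G u"
  shows "sym_diff m m' \<in> even_subsets G u"
proof -
  have "finite m" "finite m'"
    using assms finite_subset[OF _ finite_out_pairs] by (auto simp: even_subsets_def)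
  then have "even (card (sym_diff m m'))"
    using assms even_card_sym_diff unfolding even_subsets_def by blast
  then show ?thesis
    using assms by (auto simp: even_subsets_def)
qed

lemma Y_add_in_Y_graph:
  assumes "x \<in> pverts (Y_graph G)" "y \<in> pverts (Y_graph G)" "Y_proj x = Y_proj y"
  shows "Y_add x y \<in> pverts (Y_graph G)"
  using assms sym_diff_even_subsets
  by (cases "(x, y)" rule: Y_add.cases) (auto simp: Y_graph_def gadget_def image_iff)

text \<open>Each adjacency is a linear equation: the bit at \<open>e\<close> equals coordinate
  \<open>e\<close> of the vector \<open>m\<close>, or the bits at \<open>e\<close> and its reverse
  sum to 1 if \<open>e\<close> is in \<open>T\<close> and to 0 otherwise. Adding two solutions
  cancels the right-hand sides, hence the \<open>{}\<close>.\<close>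

lemma Y_adj_add:
  assumes "Y_adj G T x y" "Y_adj G T x' y'" "Y_proj x = Y_proj x'" "Y_proj y = Y_proj y'"
  shows "Y_adj G {} (Y_add x x') (Y_add y y')"
  using assms sym_diff_even_subsets
  by (cases x; cases y; cases x'; cases y') auto

lemma parcs_Y_graph: "(x, y) \<in> parcs (Y_graph G) \<longleftrightarrow> Y_adj G {} x y"
  by (cases x; cases y)
    (auto simp: Y_graph_def gadget_def symcl_iff out_pairs_def dest: parcs_sym in_arcsD1)

text \<open>Both orientations of the twisted edge enter the set because \<open>Y_adj\<close> tests
  only the arc of its first argument.\<close>

lemma parcs_Y_twisted:
  assumes "(u\<^sub>0, v\<^sub>0) \<in> parcs G"
  shows "(x, y) \<in> parcs (Y_twisted G u\<^sub>0 v\<^sub>0) \<longleftrightarrow> Y_adj G {(u\<^sub>0, v\<^sub>0), (v\<^sub>0, u\<^sub>0)} x y"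
  using assms parcs_sym[OF assms]
  by (cases x; cases y) (auto simp: Y_twisted_def symcl_iff parcs_Y_graph)

lemma homs_Y_graph:
  "homs F (Y_graph G) = {f \<in> pverts F \<rightarrow>\<^sub>E pverts (Y_graph G).
     \<forall>(x, y) \<in> parcs F. Y_adj G {} (f x) (f y)}"
  by (simp add: homs_def parcs_Y_graph)

lemma homs_Y_twisted:
  assumes "(u\<^sub>0, v\<^sub>0) \<in> parcs G"
  shows "homs F (Y_twisted G u\<^sub>0 v\<^sub>0) = {f \<in> pverts F \<rightarrow>\<^sub>E pverts (Y_graph G).
     \<forall>(x, y) \<in> parcs F. Y_adj G {(u\<^sub>0, v\<^sub>0), (v\<^sub>0, u\<^sub>0)} (f x) (f y)}"
  by (simp add: homs_def parcs_Y_twisted[OF assms]) (simp add: Y_twisted_def)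

section \<open>Translating twisted homomorphisms to untwisted ones\<close>

lemma Y_add_homs:
  assumes "pair_graph F" "(u\<^sub>0, v\<^sub>0) \<in> parcs G"
    and "h \<in> homs F (Y_twisted G u\<^sub>0 v\<^sub>0)" "g \<in> homs F (Y_twisted G u\<^sub>0 v\<^sub>0)"
    and "\<And>x. x \<in> pverts F \<Longrightarrow> Y_proj (h x) = Y_proj (g x)"
  shows "restrict (\<lambda>x. Y_add (h x) (g x)) (pverts F) \<in> homs F (Y_graph G)"
proof -
  interpret F: pair_graph F by fact
  show ?thesis
    using assms(3-5) unfolding homs_Y_graph homs_Y_twisted[OF assms(2)]
    by (auto simp: PiE_iff F.in_arcsD1 F.in_arcsD2 intro!: Y_add_in_Y_graph Y_adj_add)
qed

text \<open>Preservation of projections is what later keeps the zero lift out of the image.\<close>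

lemma inj_twisted_homs:
  assumes "pair_graph F" "(u\<^sub>0, v\<^sub>0) \<in> parcs G"
  obtains \<Phi> where "inj_on \<Phi> (homs F (Y_twisted G u\<^sub>0 v\<^sub>0))"
    and "\<Phi> ` homs F (Y_twisted G u\<^sub>0 v\<^sub>0) \<subseteq> homs F (Y_graph G)"
    and "\<And>h x. x \<in> pverts F \<Longrightarrow> Y_proj (\<Phi> h x) = Y_proj (h x)"
proof -
  let ?H = "homs F (Y_twisted G u\<^sub>0 v\<^sub>0)"
  define p where "p h = restrict (\<lambda>x. Y_proj (h x)) (pverts F)" for h :: "'b \<Rightarrow> 'a y_vertex"
  \<comment> \<open>One reference lift per projection, arbitrary if there is none. All lifts with
    the same projection are thus shifted by the same element, which gives injectivity.\<close>
  define s where "s \<phi> = (SOME g. g \<in> ?H \<and> p g = \<phi>)" for \<phi>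
  define \<Phi> where "\<Phi> h = restrict (\<lambda>x. Y_add (h x) (s (p h) x)) (pverts F)" for h
  have s: "s (p h) \<in> ?H" "p (s (p h)) = p h" if "h \<in> ?H" for h
    using someI[of "\<lambda>g. g \<in> ?H \<and> p g = p h" h] that unfolding s_def by auto
  have proj_s: "Y_proj (s (p h) x) = Y_proj (h x)" if "h \<in> ?H" "x \<in> pverts F" for h x
    using fun_cong[OF s(2)[OF that(1)], of x] that(2) by (simp add: p_def)
  have proj_\<Phi>: "Y_proj (\<Phi> h x) = Y_proj (h x)" if "x \<in> pverts F" for h x
    using that by (simp add: \<Phi>_def Y_proj_add)
  have p_\<Phi>: "p (\<Phi> h) = p h" for h
    by (auto simp: p_def proj_\<Phi>)
  have "inj_on \<Phi> ?H"
  proof (rule inj_onI)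
    fix h k assume hk: "h \<in> ?H" "k \<in> ?H" "\<Phi> h = \<Phi> k"
    then have p: "p h = p k" by (metis p_\<Phi>)
    show "h = k"
    proof (rule PiE_ext)
      show "h \<in> pverts F \<rightarrow>\<^sub>E pverts (Y_graph G)" "k \<in> pverts F \<rightarrow>\<^sub>E pverts (Y_graph G)"
        using hk(1,2) by (auto simp: homs_Y_twisted[OF assms(2)])
      fix x assume x: "x \<in> pverts F"
      show "h x = k x"
      proof (rule Y_add_cancel_right)
        show "Y_proj (h x) = Y_proj (s (p h) x)" "Y_proj (k x) = Y_proj (s (p h) x)"
          using proj_s[OF hk(1) x] proj_s[OF hk(2) x] p by auto
        show "Y_add (h x) (s (p h) x) = Y_add (k x) (s (p h) x)"
          using fun_cong[OF hk(3), of x] x p by (simp add: \<Phi>_def)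
      qed
    qed
  qed
  moreover have "\<Phi> ` ?H \<subseteq> homs F (Y_graph G)"
    unfolding \<Phi>_def using s(1) proj_s by (auto intro!: Y_add_homs[OF assms])
  ultimately show thesis
    using that proj_\<Phi> by blast
qed

section \<open>Lifts of the identity of \<open>two_subdivision G\<close>\<close>

lemma zero_lift_in_homs:
  "restrict (\<lambda>x. case x of Orig u \<Rightarrow> MV u {} | Sub e \<Rightarrow> BV e) (pverts (two_subdivision G))
     \<in> homs (two_subdivision G) (Y_graph G)"
proof -
  interpret S: pair_graph "two_subdivision G" by (rule pair_graph_two_subdivision)
  have "MV u {} \<in> pverts (Y_graph G)" if "u \<in> pverts G" for u
    using that by (auto simp: Y_graph_def gadget_def even_subsets_def intro!: bexI[of _ u])
  then show ?thesis
    unfolding homs_Y_graph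
    by (auto simp: S.in_arcsD1 S.in_arcsD2 intro: BV_in_Y_graph)
      (auto simp: two_subdivision_def symcl_iff out_pairs_def even_subsets_def
        intro: BV_in_Y_graph parcs_sym)
qed

lemma no_twisted_lift_of_id:
  assumes uv: "(u\<^sub>0, v\<^sub>0) \<in> parcs G"
    and h: "h \<in> homs (two_subdivision G) (Y_twisted G u\<^sub>0 v\<^sub>0)"
  shows "\<not> (\<forall>x \<in> pverts (two_subdivision G). Y_proj (h x) = x)"
proof
  assume id: "\<forall>x \<in> pverts (two_subdivision G). Y_proj (h x) = x"
  let ?T = "{(u\<^sub>0, v\<^sub>0), (v\<^sub>0, u\<^sub>0)}"
  have adj: "Y_adj G ?T (h x) (h y)" if "(x, y) \<in> parcs (two_subdivision G)" for x y
    using h that by (auto simp: homs_Y_twisted[OF uv])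
  define S where "S = {e \<in> parcs G. h (Sub e) = AV e}"
  have fin: "finite S"
    unfolding S_def using pair_finite_arcs by auto
  have bit: "h (Sub e) = AV e \<or> h (Sub e) = BV e" if "e \<in> parcs G" for e
    using bspec[OF id, of "Sub e"] that
    by (cases "h (Sub e)") (auto simp: two_subdivision_def)
  \<comment> \<open>An ordinary edge forces equal bits on its two arcs, the twisted edge opposite
    ones.\<close>
  have link: "((v, u) \<in> S \<longleftrightarrow> (u, v) \<in> S) \<longleftrightarrow> (u, v) \<notin> ?T" if "(u, v) \<in> parcs G" for u v
  proof -
    have "Y_adj G ?T (h (Sub (u, v))) (h (Sub (v, u)))"
      using that by (intro adj) (auto simp: two_subdivision_def symcl_iff)
    then show ?thesis
      using bit[OF that] bit[OF parcs_sym[OF that]] that parcs_sym[OF that]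
      by (auto simp: S_def)
  qed
  have "even (card (S \<inter> out_pairs G u))" if u: "u \<in> pverts G" for u
  \<comment> \<open>That \<open>m\<close> is even is read off an arc at \<open>Orig u\<close>, which
    exists only if \<open>u\<close> has a neighbour; otherwise the intersection is empty.\<close>
  proof (cases "out_pairs G u = {}")
    case False
    have "Y_proj (h (Orig u)) = Orig u"
      using id u by (auto simp: two_subdivision_def)
    then obtain m where m: "h (Orig u) = MV u m"
      by (cases "h (Orig u)") auto
    have e: "Y_adj G ?T (MV u m) (h (Sub e))" if "e \<in> out_pairs G u" for e
      using that unfolding m[symmetric]
      by (intro adj) (auto simp: two_subdivision_def symcl_iff out_pairs_def)
    have mem: "m \<in> even_subsets G u \<and> (e \<in> m \<longleftrightarrow> e \<in> S)" if "e \<in> out_pairs G u" for e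
    proof -
      have "e \<in> parcs G" using that by (auto simp: out_pairs_def)
      then show ?thesis using e[OF that] bit[of e] by (auto simp: S_def)
    qed
    have "m \<in> even_subsets G u" using mem False by blast
    moreover from this have "S \<inter> out_pairs G u = m"
      using mem by (auto simp: even_subsets_def)
    ultimately show ?thesis by (simp add: even_subsets_def)
  qed simp
  then have "even (\<Sum>u\<in>pverts G. card (S \<inter> out_pairs G u))"
    by (intro dvd_sum) auto
  \<comment> \<open>Every arc has a unique tail, so these sets partition \<open>S\<close>.\<close>
  also have "(\<Sum>u\<in>pverts G. card (S \<inter> out_pairs G u)) = card (\<Union>u\<in>pverts G. S \<inter> out_pairs G u)"
    using fin by (intro card_UN_disjoint[symmetric] pair_finite_verts) (auto simp: out_pairs_def)
  also have "(\<Union>u\<in>pverts G. S \<inter> out_pairs G u) = S"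
    by (auto simp: S_def out_pairs_def dest: in_arcsD1)
  finally have "even (card S)" .
  \<comment> \<open>Off the twisted edge \<open>link\<close> makes \<open>S\<close>
    symmetric.\<close>
  moreover have "even (card (S - ?T))"
  proof (rule even_card_sym_irrefl)
    show "sym (S - ?T)"
    proof (rule symI)
      fix u v assume "(u, v) \<in> S - ?T"
      then show "(v, u) \<in> S - ?T"
        using link[of u v] by (auto simp: S_def)
    qed
    show "irrefl (S - ?T)"
      using parcs_irrefl by (auto simp: irrefl_def S_def)
  qed (use fin in auto)
  \<comment> \<open>Exactly one arc of the twisted edge carries the bit 1, so \<open>card S\<close>
    is also odd.\<close>
  moreover have "card (S \<inter> ?T) = 1"
  proof -
    have "(v\<^sub>0, u\<^sub>0) \<in> S \<longleftrightarrow> (u\<^sub>0, v\<^sub>0) \<notin> S"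
      using link[OF uv] by auto
    then have "S \<inter> ?T = {(u\<^sub>0, v\<^sub>0)} \<or> S \<inter> ?T = {(v\<^sub>0, u\<^sub>0)}"
      by auto
    then show ?thesis by auto
  qed
  moreover have "card S = card (S \<inter> ?T) + card (S - ?T)"
    using fin by (rule card_Int_Diff)
  ultimately show False by simp
qed

end

theorem theorem12p2:
  fixes G :: "'a pair_pre_digraph" and u\<^sub>0 v\<^sub>0 :: 'a
  assumes "pair_graph G"
    and "Digraph_Component.connected (with_proj G)"
    and "card (pverts G) \<ge> 2"
    and "(u\<^sub>0, v\<^sub>0) \<in> parcs G"
  shows "hom_count (two_subdivision G) (Y_graph G)
       > hom_count (two_subdivision G) (Y_twisted G u\<^sub>0 v\<^sub>0)"
proof -
  interpret pair_graph G by fact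
  interpret S: pair_graph "two_subdivision G" by (rule pair_graph_two_subdivision)
  interpret Y: pair_graph "Y_graph G" by (rule pair_graph_Y_graph)
  let ?F = "two_subdivision G"
  let ?H = "homs ?F (Y_twisted G u\<^sub>0 v\<^sub>0)"
  let ?z = "restrict (\<lambda>x. case x of Orig u \<Rightarrow> MV u {} | Sub e \<Rightarrow> BV e) (pverts ?F)"
  obtain \<Phi> where \<Phi>: "inj_on \<Phi> ?H" "\<Phi> ` ?H \<subseteq> homs ?F (Y_graph G)"
    and proj: "\<And>h x. x \<in> pverts ?F \<Longrightarrow> Y_proj (\<Phi> h x) = Y_proj (h x)"
    using inj_twisted_homs[OF pair_graph_two_subdivision assms(4)] by blast
  \<comment> \<open>Since \<open>\<Phi>\<close> preserves projections and \<open>?z\<close> projects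
    to the identity, a preimage would be a twisted lift of the identity.\<close>
  have "?z \<notin> \<Phi> ` ?H"
  proof
    assume "?z \<in> \<Phi> ` ?H"
    then obtain h where h: "h \<in> ?H" "?z = \<Phi> h" by blast
    have "Y_proj (h x) = x" if "x \<in> pverts ?F" for x
      using proj[OF that, of h] that unfolding h(2)[symmetric] by (cases x) auto
    then show False
      using no_twisted_lift_of_id[OF assms(4) h(1)] by blast
  qed
  then have "\<Phi> ` ?H \<subset> homs ?F (Y_graph G)"
    using \<Phi>(2) zero_lift_in_homs by blast
  moreover have "finite (homs ?F (Y_graph G))"
    by (rule finite_subset[OF _ finite_PiE[OF S.pair_finite_verts Y.pair_finite_verts]])
      (auto simp: homs_def)
  ultimately have "card (\<Phi> ` ?H) < card (homs ?F (Y_graph G))"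
    by (intro psubset_card_mono)
  then show ?thesis
    by (simp add: hom_count_def card_image[OF \<Phi>(1)])
qed

end
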